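(* Let $X$ be a real Banach space and let $A:X\rightarrow X^*$ be linear, continuous and monotone. Assume that $\operatorname{ran} A=X^*$. Suppose that there exists $\delta>0$ such that $\langle Ax, x\rangle\geq\delta\|x\|^2$ for all $x\in X$. Then $X$ is reflexive.
   Context: $X$ is a real Banach space with dual $X^*$ and $\langle\cdot,\cdot\rangle$ denotes the duality pairing. A linear operator $A:X\to X^*$ is monotone if $\langle x-y,Ax-Ay\rangle\ge 0$ for all $x,y\in X$. $\operatorname{ran}A=\{Ax\mid x\in X\}$. *)

theory Defs
  imports "HOL-Analysis.Analysis"
begin

definition monotone_operator :: "('a::real_normed_vector \<Rightarrow> ('a \<Rightarrow>\<^sub>L real)) \<Rightarrow> bool" where
  "monotone_operator A \<longleftrightarrow> (\<forall>x y. blinfun_apply (A x - A y) (x - y) \<ge> 0)"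

text \<open>The canonical map into the bidual, sending a point to evaluation at that point.\<close>

lift_definition bidual_embedding ::
    "'a::real_normed_vector \<Rightarrow> (('a \<Rightarrow>\<^sub>L real) \<Rightarrow>\<^sub>L real)"
  is "\<lambda>x f. blinfun_apply f x"
  by (rule blinfun.bounded_linear_left)

text \<open>The space is the whole type, so reflexivity is a property of a type.
  It requires the canonical map itself to be onto, not just some isomorphism
  with the bidual.\<close>

definition reflexive_space :: "'a::real_normed_vector itself \<Rightarrow> bool" where
  "reflexive_space (_ :: 'a itself) \<longleftrightarrow>
     surj (bidual_embedding :: 'a \<Rightarrow> (('a \<Rightarrow>\<^sub>L real) \<Rightarrow>\<^sub>L real))"

end

theory Submission
  imports Defs
begin

text \<open>Composing the canonical map $J$ of $X$ with $A$ gives the transpose $A^T x = J x \circ A$. Since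
  $A$ is onto, reflexivity follows once $A^T$ is onto: if $\varphi \circ A = J x \circ A$ then
  $\varphi = J x$. Every convex combination $A + t (A^T - A)$ satisfies the same coercivity estimate
  as $A$, so the method of continuity carries surjectivity from $A$ to $A^T$.\<close>

text \<open>With \<open>S\<close> a right inverse of \<open>T\<close>, a solution of
  \<open>(T + B) x = y\<close> is obtained as a fixed point of
  \<open>\<lambda>x. S (y - B x)\<close>. The lower bound on \<open>T\<close> makes \<open>S\<close>
  Lipschitz with constant \<open>1 / c\<close>, so this map is a contraction with factor
  \<open>norm B / c < 1\<close> and Banach's fixed point theorem applies.\<close>

lemma surj_blinfun_add_small:
  fixes T B :: "'a::banach \<Rightarrow>\<^sub>L 'b::real_normed_vector"
  assumes surj: "surj (blinfun_apply T)"
    and below: "\<And>x. c * norm x \<le> norm (T x)"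
    and small: "norm B < c"
  shows "surj (blinfun_apply (T + B))"
proof -
  have c: "c > 0"
    using small norm_ge_zero[of B] by linarith
  define S where "S = inv (blinfun_apply T)"
  have TS: "T (S y) = y" for y
    using surj by (simp add: S_def surj_f_inv_f)
  have "\<exists>x. (T + B) x = y" for y
  proof -
    have "dist (S (y - B u)) (S (y - B v)) \<le> norm B / c * dist u v" for u v
    proof -
      \<comment> \<open>\<open>S\<close> is a mere choice of preimages, so the estimate applies
        \<open>T\<close> to the difference of two of its values: \<open>T\<close> is linear and
        undoes \<open>S\<close>.\<close>
      have "c * norm (S (y - B u) - S (y - B v)) \<le> norm (T (S (y - B u) - S (y - B v)))"
        by (rule below)
      also have "\<dots> = norm (B (v - u))"
        by (simp add: blinfun.diff_right TS)
      also have "\<dots> \<le> norm B * norm (v - u)"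
        by (rule norm_blinfun)
      finally show ?thesis
        using c by (simp add: dist_norm norm_minus_commute field_simps)
    qed
    then obtain x where "S (y - B x) = x"
      using banach_fix_type[of "norm B / c" "\<lambda>x. S (y - B x)"] c small by auto
    then have "T x = y - B x"
      using TS[of "y - B x"] by simp
    then show ?thesis
      by (intro exI[of _ x]) (simp add: blinfun.add_left)
  qed
  then show ?thesis
    unfolding surj_def by metis
qed

text \<open>The segment from \<open>T\<close> to \<open>T + B\<close> is cut into \<open>n\<close>
  equal pieces, each short enough for \<open>surj_blinfun_add_small\<close>. Because
  \<open>c\<close> is the same for all \<open>t\<close>, one \<open>n\<close> serves along the whole
  segment.\<close>

lemma method_of_continuity:
  fixes T B :: "'a::banach \<Rightarrow>\<^sub>L 'b::real_normed_vector"
  assumes surj: "surj (blinfun_apply T)"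
    and c: "c > 0"
    and below: "\<And>t x. 0 \<le> t \<Longrightarrow> t \<le> 1 \<Longrightarrow> c * norm x \<le> norm ((T + t *\<^sub>R B) x)"
  shows "surj (blinfun_apply (T + B))"
proof -
  obtain n :: nat where n: "norm B / c < real n"
    using reals_Archimedean2 by blast
  have n0: "n > 0"
    using n c by (cases n) (auto simp: divide_less_0_iff not_less)
  have step: "norm ((1 / real n) *\<^sub>R B) < c"
    using n c n0 by (simp add: field_simps)
  have "k \<le> n \<Longrightarrow> surj (blinfun_apply (T + (real k / real n) *\<^sub>R B))" for k
  proof (induction k)
    case 0
    then show ?case using surj by simp
  next
    case (Suc k)
    have "surj (blinfun_apply ((T + (real k / real n) *\<^sub>R B) + (1 / real n) *\<^sub>R B))"
    proof (rule surj_blinfun_add_small[OF _ _ step])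
      show "surj (blinfun_apply (T + (real k / real n) *\<^sub>R B))"
        using Suc by simp
      show "c * norm x \<le> norm ((T + (real k / real n) *\<^sub>R B) x)" for x
        using Suc.prems n0 by (intro below) auto
    qed
    then show ?case
      by (simp add: add.assoc add_divide_distrib flip: scaleR_add_left) (simp add: add.commute)
  qed
  from this[of n] n0 show ?thesis by simp
qed

lemma bounded_linear_bidual_embedding:
  "bounded_linear (bidual_embedding :: 'a::real_normed_vector \<Rightarrow> _)"
proof (rule bounded_linear_intro[where K = 1])
  show "norm (bidual_embedding x) \<le> norm x * 1" for x :: 'a
  proof (rule norm_blinfun_bound)
    show "norm (bidual_embedding x f) \<le> norm x * 1 * norm f" for f
      using norm_blinfun[of f x] by (simp add: bidual_embedding.rep_eq mult.commute)
  qed simp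
qed (auto intro!: blinfun_eqI simp: bidual_embedding.rep_eq blinfun.bilinear_simps)

lemma linear_continuous_imp_bounded_linear:
  fixes f :: "'a::real_normed_vector \<Rightarrow> 'b::real_normed_vector"
  assumes "linear f" and "isCont f 0"
  shows "bounded_linear f"
proof -
  interpret linear f by fact
  obtain d where d: "d > 0" "\<And>x. norm x < d \<Longrightarrow> norm (f x) < 1"
    using assms(2)[unfolded continuous_at_eps_delta, rule_format, OF zero_less_one]
    by (auto simp: zero)
  have "norm (f x) \<le> norm x * (2 / d)" for x
  proof (cases "x = 0")
    case True
    then show ?thesis by (simp add: zero)
  next
    case False
    \<comment> \<open>This factor rescales \<open>x\<close> to norm \<open>d / 2\<close>, inside the
      ball where \<open>f\<close> has norm below 1.\<close>
    define r where "r = d / (2 * norm x)"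
    have r: "r > 0" "norm (r *\<^sub>R x) < d"
      using d(1) False by (auto simp: r_def)
    have "r * norm (f x) = norm (f (r *\<^sub>R x))"
      using r(1) by (simp add: scale)
    also have "\<dots> \<le> 1"
      using d(2)[OF r(2)] by simp
    finally show ?thesis
      using False d(1) by (simp add: r_def field_simps)
  qed
  then show ?thesis
    by (intro bounded_linear_intro[where K = "2 / d"]) (auto simp: add scale)
qed

text \<open>Cancel \<open>norm x\<close> in \<open>f x \<le> norm f * norm x\<close>. This turns
  coercivity into the lower bound in the dual norm that \<open>method_of_continuity\<close> asks
  for.\<close>

lemma coercive_imp_bounded_below:
  fixes f :: "'a::real_normed_vector \<Rightarrow>\<^sub>L real"
  assumes "\<delta> * (norm x)\<^sup>2 \<le> f x"
  shows "\<delta> * norm x \<le> norm f"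
proof (cases "x = 0")
  case False
  have "(\<delta> * norm x) * norm x \<le> f x"
    using assms by (simp add: power2_eq_square mult.assoc)
  also have "\<dots> \<le> norm f * norm x"
    using norm_blinfun[of f x] by simp
  finally show ?thesis
    using False by simp
qed simp

theorem corollary3p19:
  fixes A :: "'a::banach \<Rightarrow> ('a \<Rightarrow>\<^sub>L real)" and \<delta> :: real
  assumes "linear A"
    and "continuous_on UNIV A"
    and "monotone_operator A"
    and "range A = UNIV"
    and "\<delta> > 0"
    and "\<And>x. blinfun_apply (A x) x \<ge> \<delta> * (norm x)\<^sup>2"
  shows "reflexive_space TYPE('a)"
proof -
  have "bounded_linear A"
    using assms(1,2)
    by (simp add: linear_continuous_imp_bounded_linear continuous_on_eq_continuous_at)
  then obtain T where T: "A = blinfun_apply T"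
    by (rule that[OF bounded_linear_Blinfun_apply[symmetric]])
  \<comment> \<open>This map is the transpose of \<open>T\<close> restricted to the canonical image
    of the space in its bidual.\<close>
  have "bounded_linear (\<lambda>x. bidual_embedding x o\<^sub>L T)"
    by (intro bounded_linear_compose[OF bounded_bilinear.bounded_linear_left[OF
          bounded_bilinear_blinfun_compose]]
        bounded_linear_bidual_embedding)
  then obtain T' where T': "blinfun_apply T' = (\<lambda>x. bidual_embedding x o\<^sub>L T)"
    by (rule that[OF bounded_linear_Blinfun_apply])
  have T'_apply: "T' x y = T y x" for x y
    by (simp add: T' bidual_embedding.rep_eq)
  have "surj (blinfun_apply (T + (T' - T)))"
  proof (rule method_of_continuity[OF _ \<open>\<delta> > 0\<close>])
    show "surj (blinfun_apply T)"
      using assms(4) T by simp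
    show "\<delta> * norm x \<le> norm ((T + t *\<^sub>R (T' - T)) x)" for t x
    proof (rule coercive_imp_bounded_below)
      \<comment> \<open>\<open>T' - T\<close> is skew: it vanishes on the diagonal because
        \<open>T' x x = T x x\<close>. Hence the quadratic form does not depend on
        \<open>t\<close>.\<close>
      have "(T + t *\<^sub>R (T' - T)) x x = T x x"
        by (simp add: blinfun.bilinear_simps T'_apply)
      then show "\<delta> * (norm x)\<^sup>2 \<le> (T + t *\<^sub>R (T' - T)) x x"
        using assms(6)[of x] T by simp
    qed
  qed
  then have surj': "surj (blinfun_apply T')"
    by simp
  have "\<exists>x. \<phi> = bidual_embedding x" for \<phi> :: "('a \<Rightarrow>\<^sub>L real) \<Rightarrow>\<^sub>L real"
  proof -
    obtain x where "\<phi> o\<^sub>L T = T' x"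
      using surj' by (rule surjE)
    then have x: "\<phi> o\<^sub>L T = bidual_embedding x o\<^sub>L T"
      by (simp add: T')
    have "\<phi> f = bidual_embedding x f" for f
    proof -
      \<comment> \<open>The identity \<open>x\<close> compares the two functionals only on the range
        of \<open>A\<close>, which is the whole dual.\<close>
      obtain y where "f = A y"
        using assms(4) by (rule surjE)
      then show ?thesis
        using arg_cong[OF x, of "\<lambda>g. blinfun_apply g y"] by (simp add: T)
    qed
    then show ?thesis
      by (intro exI[of _ x] blinfun_eqI)
  qed
  then show ?thesis
    by (simp add: reflexive_space_def surj_def)
qed

end
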